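(* Let $\lambda>0$, let $\mu$ be a probability distribution on $(0,+\infty)$, and let $\rho$ be a random variable with distribution $\mu$. Let $\mathcal{P}$ be a Poisson point process on $\mathbb{R}\times(0,+\infty)$ with intensity measure $\lambda\,du\times\mu$, and let $$\mathcal{U}_+=\bigcup_{(u,\rho_u)\in\mathcal{P}:\,u\ge 0}[u,u+\rho_u]\subset\mathbb{R}_+=[0,\infty)$$ be the occupied set of totally asymmetric Boolean percolation on $\mathbb{R}_+$. Write $a\wedge b=\min(a,b)$. Then: (a) almost surely there exists an unbounded occupied component if and only if $\int_0^\infty e^{-\lambda\mathbb{E}(\rho\wedge t)}\,dt<\infty$; that is, $\mathbb{P}\{\mathcal{U}_+\text{ has an unbounded connected component}\}=1$ if and only if this integral is finite; (b) almost surely there is no unbounded occupied component if and only if $\int_0^\infty e^{-\lambda\mathbb{E}(\rho\wedge t)}\,dt=\infty$; that is, $\mathbb{P}\{\mathcal{U}_+\text{ has an unbounded connected component}\}=0$ if and only if this integral is infinite.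
   Context: An occupied component is a connected component of the occupied set $\mathcal{U}_+$. *)

theory Defs
  imports "HOL-Probability.Probability"
begin

text \<open>
  A Poisson point process is represented by the random countable set of its points.
  This loses nothing when the intensity measure is diffuse, since the process is then almost
  surely simple. The number of points in a set takes values in \<^typ>\<open>ennreal\<close>,
  so that it may be infinite.
\<close>

definition num_points :: "'e set \<Rightarrow> 'e set \<Rightarrow> ennreal" where
  "num_points X B = emeasure (count_space UNIV) (X \<inter> B)"

text \<open>
  The state space is \<^term>\<open>space \<Lambda>\<close>. The formula for the Poisson weights also
  covers intensity 0, because \<^term>\<open>0 ^ 0 = (1::real)\<close>.
\<close>

definition poisson_point_process ::
    "'w measure \<Rightarrow> 'e measure \<Rightarrow> ('w \<Rightarrow> 'e set) \<Rightarrow> bool" where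
  "poisson_point_process M \<Lambda> X \<longleftrightarrow>
     prob_space M \<and>
     (\<forall>\<omega>\<in>space M. countable (X \<omega>) \<and> X \<omega> \<subseteq> space \<Lambda>) \<and>
     (\<forall>B\<in>sets \<Lambda>. (\<lambda>\<omega>. num_points (X \<omega>) B) \<in> borel_measurable M) \<and>
     (\<forall>B\<in>sets \<Lambda>. emeasure \<Lambda> B < \<infinity> \<longrightarrow>
        (\<forall>k::nat. measure M {\<omega>\<in>space M. num_points (X \<omega>) B = of_nat k}
                   = measure \<Lambda> B ^ k / fact k * exp (- measure \<Lambda> B))) \<and>
     (\<forall>B\<in>sets \<Lambda>. emeasure \<Lambda> B = \<infinity> \<longrightarrow>
        (AE \<omega> in M. num_points (X \<omega>) B = \<infinity>)) \<and>
     (\<forall>(n::nat) B. (\<forall>i<n. B i \<in> sets \<Lambda>) \<and> disjoint_family_on B {..<n} \<longrightarrow>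
        prob_space.indep_vars M (\<lambda>_. borel) (\<lambda>i \<omega>. num_points (X \<omega>) (B i)) {..<n})"

definition occupied_set :: "(real \<times> real) set \<Rightarrow> real set" where
  "occupied_set X = (\<Union>(u, r)\<in>{(u, r). (u, r) \<in> X \<and> u \<ge> 0}. {u..u + r})"

definition has_unbounded_component :: "real set \<Rightarrow> bool" where
  "has_unbounded_component U \<longleftrightarrow> (\<exists>C\<in>components U. \<not> bounded C)"

end

theory Submission
  imports Defs
begin

text \<open>
  A point \<open>x \<ge> 0\<close> is vacant iff no point \<open>(u, r)\<close> of the process satisfies
  \<open>0 \<le> u \<le> x \<le> u + r\<close>; this has probability
  \<open>f x = exp (- \<lambda> E(\<rho> \<and> x))\<close>, and \<open>f\<close> is decreasing, so \<open>\<integral> f\<close> and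
  \<open>\<Sum>n. f n\<close> are finite together.

  If \<open>[n, n + 1]\<close> is not contained in a single interval started in \<open>[0, n]\<close>, then no point
  of the process has \<open>0 \<le> u \<le> n\<close> and \<open>u + r \<ge> n + 1\<close>, which has probability at most
  \<open>exp \<lambda> \<cdot> f (n + 1)\<close>. If the integral is finite, Borel-Cantelli shows that a half-line is
  occupied.

  The vacant integers form a renewal process: the probability that \<open>m\<close> is the last one is
  \<open>f m \<cdot> q\<close> with \<open>q\<close> independent of \<open>m\<close>. These events are disjoint, so \<open>q = 0\<close> as soon
  as \<open>\<Sum>n. f n\<close> diverges. Since \<open>0\<close> is almost surely vacant, there are then infinitely many
  vacant integers.
\<close>

section \<open>Integral and series of a decreasing function\<close>

text \<open>On \<open>[n, n + 1)\<close> the value at the left end point dominates \<open>f\<close>.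
  Measurability enters only for the step function, when sum and integral are exchanged. This bound
  serves the divergent case.\<close>

lemma nn_integral_antimono_le_suminf:
  fixes f :: "real \<Rightarrow> ennreal"
  assumes anti: "\<And>s t. 0 \<le> s \<Longrightarrow> s \<le> t \<Longrightarrow> f t \<le> f s"
  shows "(\<integral>\<^sup>+ t\<in>{0..}. f t \<partial>lborel) \<le> (\<Sum>n. f (real n))"
proof -
  have "(\<integral>\<^sup>+ t\<in>{0..}. f t \<partial>lborel)
      \<le> (\<integral>\<^sup>+ t. (\<Sum>n. f (real n) * indicator {real n..<real n + 1} t) \<partial>lborel)"
  proof (rule nn_integral_mono)
    fix t :: real
    show "f t * indicator {0..} t \<le> (\<Sum>n. f (real n) * indicator {real n..<real n + 1} t)"
    proof (cases "t \<ge> 0")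
      case True
      define n where "n = nat \<lfloor>t\<rfloor>"
      have n: "real n \<le> t" "t < real n + 1"
        using True by (auto simp: n_def)
      have "f t * indicator {0..} t \<le> f (real n) * indicator {real n..<real n + 1} t"
        using n True anti[of "real n" t] by simp
      also have "\<dots> \<le> (\<Sum>n. f (real n) * indicator {real n..<real n + 1} t)"
        using sum_le_suminf[of "\<lambda>n. f (real n) * indicator {real n..<real n + 1} t" "{n}"]
        by (simp del: sum_mult_indicator)
      finally show ?thesis .
    qed simp
  qed
  also have "\<dots> = (\<Sum>n. \<integral>\<^sup>+ t. f (real n) * indicator {real n..<real n + 1} t \<partial>lborel)"
    by (rule nn_integral_suminf) simp
  also have "\<dots> = (\<Sum>n. f (real n))"
    by (subst nn_integral_cmult_indicator) auto
  finally show ?thesis .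
qed

text \<open>With the value at the right end point the step function lies below \<open>f\<close>;
  this bound serves the convergent case.\<close>

lemma suminf_Suc_le_nn_integral_antimono:
  fixes f :: "real \<Rightarrow> ennreal"
  assumes anti: "\<And>s t. 0 \<le> s \<Longrightarrow> s \<le> t \<Longrightarrow> f t \<le> f s"
  shows "(\<Sum>n. f (real n + 1)) \<le> (\<integral>\<^sup>+ t\<in>{0..}. f t \<partial>lborel)"
proof -
  have "(\<Sum>n. f (real n + 1))
      = (\<Sum>n. \<integral>\<^sup>+ t. f (real n + 1) * indicator {real n..<real n + 1} t \<partial>lborel)"
    by (subst nn_integral_cmult_indicator) auto
  also have "\<dots> = (\<integral>\<^sup>+ t. (\<Sum>n. f (real n + 1) * indicator {real n..<real n + 1} t) \<partial>lborel)"
    by (rule nn_integral_suminf[symmetric]) simp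
  also have "\<dots> \<le> (\<integral>\<^sup>+ t\<in>{0..}. f t \<partial>lborel)"
  proof (rule nn_integral_mono)
    fix t :: real
    \<comment> \<open>For negative \<open>t\<close> this gives \<open>n = 0\<close>, and both sides
      of the inequality vanish.\<close>
    define n where "n = nat \<lfloor>t\<rfloor>"
    have "(\<Sum>k. f (real k + 1) * indicator {real k..<real k + 1} t)
        = (\<Sum>k\<in>{n}. f (real k + 1) * indicator {real k..<real k + 1} t)"
    proof (rule suminf_finite)
      fix k assume "k \<notin> {n}"
      then have "\<not> (real k \<le> t \<and> t < real k + 1)"
        unfolding n_def by (auto, linarith)
      then show "f (real k + 1) * indicator {real k..<real k + 1} t = 0"
        by (auto simp: indicator_def)
    qed simp
    also have "\<dots> = f (real n + 1) * indicator {real n..<real n + 1} t"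
      by (simp only: sum.insert sum.empty finite.emptyI empty_iff not_False_eq_True add_0_right)
    also have "\<dots> \<le> f t * indicator {0..} t"
      using anti[of t "real n + 1"] by (auto simp: indicator_def)
    finally show "(\<Sum>k. f (real k + 1) * indicator {real k..<real k + 1} t)
        \<le> f t * indicator {0..} t" .
  qed
  finally show ?thesis .
qed

section \<open>Unbounded components of subsets of the line\<close>

lemma has_unbounded_componentI:
  assumes "{a..} \<subseteq> U"
  shows "has_unbounded_component U"
proof -
  have "a \<in> U"
    using assms by auto
  then have "connected_component_set U a \<in> components U"
    by (simp add: componentsI)
  moreover have "{a..} \<subseteq> connected_component_set U a"
    using assms by (intro connected_component_maximal) auto
  moreover have "\<not> bounded {a..}"
  proof
    assume "bounded {a..}"
    then obtain b where "\<And>x. a \<le> x \<Longrightarrow> x \<le> b"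
      by (metis atLeast_iff bdd_above_def bounded_imp_bdd_above)
    from this[of "max a b + 1"] show False
      by linarith
  qed
  ultimately show ?thesis
    unfolding has_unbounded_component_def using bounded_subset by blast
qed

text \<open>Connected sets of reals are intervals. An unbounded component inside the half-line would
  have points on both sides of some vacant \<open>x\<close>, hence contain it.\<close>

lemma not_has_unbounded_componentI:
  assumes nonneg: "U \<subseteq> {0..}" and vacant: "\<And>b. \<exists>x>b. x \<notin> U"
  shows "\<not> has_unbounded_component U"
proof
  assume "has_unbounded_component U"
  then obtain C where C: "C \<in> components U" "\<not> bounded C"
    by (auto simp: has_unbounded_component_def)
  have CU: "C \<subseteq> U" and conn: "connected C"
    using C(1) by (auto simp: in_components_subset in_components_connected)
  obtain c where c: "c \<in> C"
    using C(2) by fastforce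
  obtain x where x: "x > c" "x \<notin> U"
    using vacant by blast
  have "\<not> C \<subseteq> {0..x}"
    using C(2) bounded_subset bounded_closed_interval by blast
  then obtain d where d: "d \<in> C" "d > x"
    using CU nonneg by force
  have "x \<in> C"
    using connectedD_interval[OF conn c d(1)] x d by auto
  then show False
    using CU x by auto
qed

section \<open>Recurrence of discrete renewal events\<close>

context prob_space
begin

text \<open>
  Summing the hypothesis over \<open>m < K\<close> with \<open>N = K\<close> gives disjoint
  events, so \<open>q K\<close> is at most the reciprocal of the \<open>K\<close>-th partial
  sum of a divergent series.
\<close>
lemma renewal_recurrence:
  fixes A :: "nat \<Rightarrow> 'a set" and q :: "nat \<Rightarrow> real"
  assumes A: "\<And>n. A n \<in> events"
    and renewal: "\<And>m N. prob {\<omega>\<in>space M. \<omega> \<in> A m \<and> (\<forall>k\<in>{1..N}. \<omega> \<notin> A (m + k))} = prob (A m) * q N"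
    and diverges: "\<not> summable (\<lambda>n. prob (A n))"
  shows "AE \<omega> in M. \<forall>m. \<omega> \<in> A m \<longrightarrow> (\<exists>n>m. \<omega> \<in> A n)"
  unfolding AE_all_countable
proof
  fix m
  note [measurable] = A
  define L where "L m N = {\<omega>\<in>space M. \<omega> \<in> A m \<and> (\<forall>k\<in>{1..N}. \<omega> \<notin> A (m + k))}" for m N
  have L[measurable]: "L m N \<in> events" for m N
    unfolding L_def by measurable
  define B where "B = {\<omega>\<in>space M. \<not> (\<omega> \<in> A m \<longrightarrow> (\<exists>n>m. \<omega> \<in> A n))}"
  have B[measurable]: "B \<in> events"
    unfolding B_def by measurable
  have "prob B = 0"
  proof (rule ccontr)
    assume "prob B \<noteq> 0"
    then have pos: "prob B > 0"
      by (simp add: zero_less_measure_iff)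
    have q: "prob B \<le> q K" for K
    proof -
      have le: "prob B \<le> prob (A m) * q K"
        unfolding renewal[symmetric] using L[of m K]
        by (intro finite_measure_mono) (auto simp: B_def L_def)
      with pos have "0 < q K"
        by (metis less_le_trans measure_nonneg not_less zero_less_mult_iff)
      with le show ?thesis
        using mult_right_mono[OF prob_le_1 less_imp_le[OF \<open>0 < q K\<close>], of "A m"] by linarith
    qed
    have "(\<Sum>j<K. prob (A j)) \<le> 1 / prob B" for K
    proof -
      have "disjoint_family_on (\<lambda>j. L j K) {..<K}"
        unfolding disjoint_family_on_def
      proof (intro ballI impI)
        fix i j assume "i \<in> {..<K}" "j \<in> {..<K}" "i \<noteq> j"
        \<comment> \<open>The first event forbids \<open>A j\<close>, as \<open>j - i\<close> lies
          within the window \<open>{1..K}\<close>; the second requires it.\<close>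
        moreover have "L i K \<inter> L j K = {}" if "i < j" "j < K" for i j
        proof -
          have "j - i \<in> {1..K}" "i + (j - i) = j"
            using that by auto
          then show ?thesis
            unfolding L_def by (metis (no_types, lifting) Int_emptyI mem_Collect_eq)
        qed
        ultimately show "L i K \<inter> L j K = {}"
          by (metis Int_commute lessThan_iff nat_neq_iff)
      qed
      then have "(\<Sum>j<K. prob (L j K)) = prob (\<Union>j<K. L j K)"
        by (intro finite_measure_finite_Union[symmetric]) auto
      also have "\<dots> \<le> 1"
        by simp
      finally have "(\<Sum>j<K. prob (A j)) * q K \<le> 1"
        unfolding L_def renewal by (simp add: sum_distrib_right)
      moreover have "(\<Sum>j<K. prob (A j)) * prob B \<le> (\<Sum>j<K. prob (A j)) * q K"
        by (intro mult_left_mono q sum_nonneg) simp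
      ultimately show ?thesis
        using pos by (simp add: field_simps)
    qed
    then have "summable (\<lambda>n. prob (A n))"
      by (intro summableI_nonneg_bounded) auto
    with diverges show False ..
  qed
  then show "AE \<omega> in M. \<omega> \<in> A m \<longrightarrow> (\<exists>n>m. \<omega> \<in> A n)"
    by (intro AE_I[OF _ _ B]) (auto simp: B_def emeasure_eq_measure)
qed

end

section \<open>Void probabilities of a Poisson process\<close>

text \<open>Avoiding several sets is avoiding their union, so void probabilities determine all joint
  hit-or-miss probabilities. Independence over disjoint regions is recovered from additivity of the
  intensity in the exponent.\<close>

locale poisson_avoidance = prob_space M for M :: "'w measure" +
  fixes \<Lambda> :: "'e measure" and X :: "'w \<Rightarrow> 'e set"
  assumes avoid_sets[measurable]: "B \<in> sets \<Lambda> \<Longrightarrow> {\<omega>\<in>space M. X \<omega> \<inter> B = {}} \<in> events"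
    and avoid_prob: "B \<in> fmeasurable \<Lambda> \<Longrightarrow> prob {\<omega>\<in>space M. X \<omega> \<inter> B = {}} = exp (- measure \<Lambda> B)"
begin

lemma hit_sets:
  assumes "finite F" "G \<in> fmeasurable \<Lambda>" "\<And>i. i \<in> F \<Longrightarrow> D i \<in> fmeasurable \<Lambda>"
  shows "{\<omega>\<in>space M. X \<omega> \<inter> G = {} \<and> (\<forall>i\<in>F. X \<omega> \<inter> D i \<noteq> {})} \<in> events"
proof -
  have "{\<omega>\<in>space M. X \<omega> \<inter> G = {} \<and> (\<forall>i\<in>F. X \<omega> \<inter> D i \<noteq> {})}
      = {\<omega>\<in>space M. X \<omega> \<inter> G = {}} - (\<Union>i\<in>F. {\<omega>\<in>space M. X \<omega> \<inter> D i = {}})"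
    by auto
  also have "\<dots> \<in> events"
    using assms by (intro sets.Diff sets.finite_UN avoid_sets) (auto dest: fmeasurableD)
  finally show ?thesis .
qed

text \<open>
  By inclusion-exclusion, these probabilities depend only on the intensities of the sets
  \<open>G \<union> (\<Union>i\<in>S. D i)\<close>.
\<close>
lemma hit_prob_factor:
  assumes "finite F"
    and "\<And>i. i \<in> F \<Longrightarrow> D i \<in> fmeasurable \<Lambda>" "\<And>i. i \<in> F \<Longrightarrow> D' i \<in> fmeasurable \<Lambda>"
    and "G \<in> fmeasurable \<Lambda>" "G' \<in> fmeasurable \<Lambda>"
    and "\<And>S. S \<subseteq> F \<Longrightarrow> measure \<Lambda> (G \<union> (\<Union>i\<in>S. D i)) = c + measure \<Lambda> (G' \<union> (\<Union>i\<in>S. D' i))"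
  shows "prob {\<omega>\<in>space M. X \<omega> \<inter> G = {} \<and> (\<forall>i\<in>F. X \<omega> \<inter> D i \<noteq> {})}
    = exp (- c) * prob {\<omega>\<in>space M. X \<omega> \<inter> G' = {} \<and> (\<forall>i\<in>F. X \<omega> \<inter> D' i \<noteq> {})}"
  using assms
proof (induction F arbitrary: G G' rule: finite_induct)
  case empty
  then show ?case
    using empty(5)[of "{}"] by (simp add: avoid_prob exp_add[symmetric])
next
  case (insert j F)
  \<comment> \<open>Subtracting the outcomes that miss \<open>C j\<close> enlarges the avoided set
    to \<open>H \<union> C j\<close>, which is why the induction varies \<open>G\<close> and
    \<open>G'\<close>.\<close>
  have split: "prob {\<omega>\<in>space M. X \<omega> \<inter> H = {} \<and> (\<forall>i\<in>insert j F. X \<omega> \<inter> C i \<noteq> {})}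
      = prob {\<omega>\<in>space M. X \<omega> \<inter> H = {} \<and> (\<forall>i\<in>F. X \<omega> \<inter> C i \<noteq> {})}
      - prob {\<omega>\<in>space M. X \<omega> \<inter> (H \<union> C j) = {} \<and> (\<forall>i\<in>F. X \<omega> \<inter> C i \<noteq> {})}"
    if "H \<in> fmeasurable \<Lambda>" "\<And>i. i \<in> insert j F \<Longrightarrow> C i \<in> fmeasurable \<Lambda>" for H C
  proof -
    have "{\<omega>\<in>space M. X \<omega> \<inter> H = {} \<and> (\<forall>i\<in>insert j F. X \<omega> \<inter> C i \<noteq> {})}
      = {\<omega>\<in>space M. X \<omega> \<inter> H = {} \<and> (\<forall>i\<in>F. X \<omega> \<inter> C i \<noteq> {})}
      - {\<omega>\<in>space M. X \<omega> \<inter> (H \<union> C j) = {} \<and> (\<forall>i\<in>F. X \<omega> \<inter> C i \<noteq> {})}"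
      by auto
    then show ?thesis
      using that insert.hyps(1)
      by (auto intro!: finite_measure_Diff hit_sets)
  qed
  \<comment> \<open>The enlarged avoided sets satisfy the hypothesis with the same \<open>c\<close>:
    absorb \<open>j\<close> into the index set.\<close>
  have "measure \<Lambda> ((G \<union> D j) \<union> (\<Union>i\<in>S. D i)) = c + measure \<Lambda> ((G' \<union> D' j) \<union> (\<Union>i\<in>S. D' i))"
    if "S \<subseteq> F" for S
    using insert.prems(5)[of "insert j S"] that by (simp add: Un_assoc subset_insertI2)
  then have "prob {\<omega>\<in>space M. X \<omega> \<inter> (G \<union> D j) = {} \<and> (\<forall>i\<in>F. X \<omega> \<inter> D i \<noteq> {})}
    = exp (- c) * prob {\<omega>\<in>space M. X \<omega> \<inter> (G' \<union> D' j) = {} \<and> (\<forall>i\<in>F. X \<omega> \<inter> D' i \<noteq> {})}"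
    using insert.prems by (intro insert.IH) auto
  moreover have "prob {\<omega>\<in>space M. X \<omega> \<inter> G = {} \<and> (\<forall>i\<in>F. X \<omega> \<inter> D i \<noteq> {})}
    = exp (- c) * prob {\<omega>\<in>space M. X \<omega> \<inter> G' = {} \<and> (\<forall>i\<in>F. X \<omega> \<inter> D' i \<noteq> {})}"
    using insert.prems by (intro insert.IH) auto
  ultimately show ?case
    using insert.prems by (simp only: split right_diff_distrib)
qed

end

text \<open>Missing \<open>B\<close> means having no points there, so the void probability is the
  Poisson weight at \<open>k = 0\<close>.\<close>

lemma poisson_avoidanceI:
  assumes "poisson_point_process M \<Lambda> X"
  shows "poisson_avoidance M \<Lambda> X"
proof -
  have "prob_space M"
    using assms by (simp add: poisson_point_process_def)
  then interpret prob_space M .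
  have zero: "num_points (X \<omega>) B = 0 \<longleftrightarrow> X \<omega> \<inter> B = {}" for \<omega> B
    unfolding num_points_def by (simp add: emeasure_count_space_eq_0)
  have meas: "(\<lambda>\<omega>. num_points (X \<omega>) B) \<in> borel_measurable M" if "B \<in> sets \<Lambda>" for B
    using assms that by (simp add: poisson_point_process_def)
  show ?thesis
  proof
    fix B assume "B \<in> sets \<Lambda>"
    note [measurable] = meas[OF this]
    have "{\<omega>\<in>space M. num_points (X \<omega>) B = 0} \<in> events"
      by measurable
    then show "{\<omega>\<in>space M. X \<omega> \<inter> B = {}} \<in> events"
      by (simp add: zero)
  next
    fix B assume "B \<in> fmeasurable \<Lambda>"
    then have "\<forall>k::nat. measure M {\<omega>\<in>space M. num_points (X \<omega>) B = of_nat k}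
        = measure \<Lambda> B ^ k / fact k * exp (- measure \<Lambda> B)"
      using assms unfolding poisson_point_process_def fmeasurable_def by blast
    from spec[OF this, of 0] show "prob {\<omega>\<in>space M. X \<omega> \<inter> B = {}} = exp (- measure \<Lambda> B)"
      by (simp add: zero)
  qed
qed

section \<open>The percolation model and its intensity measure\<close>

locale boolean_percolation =
  poisson_avoidance M "scale_measure (ennreal lam) lborel \<Otimes>\<^sub>M \<mu>" X + mark: prob_space \<mu>
  for M :: "'w measure" and lam :: real and \<mu> :: "real measure"
    and X :: "'w \<Rightarrow> (real \<times> real) set" +
  assumes lam_pos: "lam > 0"
    and sets_mark: "sets \<mu> = sets (restrict_space borel {0<..})"
    and points_in_space: "\<omega> \<in> space M \<Longrightarrow> X \<omega> \<subseteq> UNIV \<times> space \<mu>"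
begin

abbreviation \<Lambda> :: "(real \<times> real) measure" where
  "\<Lambda> \<equiv> scale_measure (ennreal lam) lborel \<Otimes>\<^sub>M \<mu>"

lemma space_mark: "space \<mu> = {0<..}"
  using sets_eq_imp_space_eq[OF sets_mark] by (simp add: space_restrict_space)

lemma space_intensity: "space \<Lambda> = UNIV \<times> {0<..}"
  by (simp add: space_pair_measure space_mark space_scale_measure)

lemma sets_intensity: "sets \<Lambda> = sets (lborel \<Otimes>\<^sub>M \<mu>)"
  by (intro sets_pair_measure_cong) auto

lemma measurable_mark[measurable]: "(\<lambda>r. r) \<in> borel_measurable \<mu>"
  using measurable_restrict_space1[OF measurable_ident, of "borel :: real measure" "{0<..}"]
  by (simp add: measurable_cong_sets[OF sets_mark refl] id_def)

text \<open>Slicing by mark leaves subsets of the line, whose lengths are explicit and translation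
  invariant.\<close>

lemma emeasure_intensity:
  assumes "B \<in> sets \<Lambda>"
  shows "emeasure \<Lambda> B = ennreal lam * (\<integral>\<^sup>+ r. emeasure lborel ((\<lambda>u. (u, r)) -` B) \<partial>\<mu>)"
proof -
  interpret pair_sigma_finite lborel \<mu> ..
  have B[measurable]: "B \<in> sets (lborel \<Otimes>\<^sub>M \<mu>)"
    using assms sets_intensity by simp
  have "emeasure \<Lambda> B = (\<integral>\<^sup>+ u. emeasure \<mu> (Pair u -` B) \<partial>scale_measure (ennreal lam) lborel)"
    by (rule mark.emeasure_pair_measure_alt[OF assms])
  \<comment> \<open>The scale factor comes out first, since the order of integration is exchanged
    for \<open>lborel\<close> and \<open>\<mu>\<close>.\<close>
  also have "\<dots> = ennreal lam * (\<integral>\<^sup>+ u. emeasure \<mu> (Pair u -` B) \<partial>lborel)"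
    using mark.measurable_emeasure_Pair[OF B] by (intro nn_integral_scale_measure) simp
  also have "(\<integral>\<^sup>+ u. emeasure \<mu> (Pair u -` B) \<partial>lborel) = emeasure (lborel \<Otimes>\<^sub>M \<mu>) B"
    by (rule mark.emeasure_pair_measure_alt[OF B, symmetric])
  also have "\<dots> = (\<integral>\<^sup>+ r. emeasure lborel ((\<lambda>u. (u, r)) -` B) \<partial>\<mu>)"
    by (rule emeasure_pair_measure_alt2[OF B])
  finally show ?thesis .
qed

text \<open>Stationarity in the starting point: for each mark, the slices are translates by
  \<open>a\<close>, and Lebesgue measure is invariant.\<close>

lemma emeasure_intensity_translate:
  assumes B: "B \<in> sets \<Lambda>" and B': "B' \<in> sets \<Lambda>"
    and shift: "\<And>u r. (a + u, r) \<in> B' \<longleftrightarrow> (u, r) \<in> B"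
  shows "emeasure \<Lambda> B' = emeasure \<Lambda> B"
proof -
  have "emeasure lborel ((\<lambda>u. (u, r)) -` B') = emeasure lborel ((\<lambda>u. (u, r)) -` B)" for r
  proof -
    have [measurable]: "(\<lambda>u. (u, r)) -` B' \<in> sets borel"
      using sets_Pair2[of B' lborel \<mu> r] B' sets_intensity by simp
    have "emeasure lborel ((\<lambda>u. (u, r)) -` B')
        = emeasure (distr lborel borel ((+) a)) ((\<lambda>u. (u, r)) -` B')"
      by (simp add: lborel_distr_plus)
    also have "\<dots> = emeasure lborel ((\<lambda>u. (u, r)) -` B)"
      using shift by (subst emeasure_distr) (auto intro!: arg_cong[where f = "emeasure lborel"])
    finally show ?thesis .
  qed
  then show ?thesis
    unfolding emeasure_intensity[OF B] emeasure_intensity[OF B'] by simp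
qed

text \<open>Avoiding \<open>reach {0..x} x\<close> makes \<open>x\<close> vacant; hitting
  \<open>reach {0..x} (x + 1)\<close> covers all of \<open>[x, x + 1]\<close> by one interval;
  \<open>{a<..x}\<close> admits only starts after \<open>a\<close>.\<close>

definition reach :: "real set \<Rightarrow> real \<Rightarrow> (real \<times> real) set" where
  "reach J x = {p \<in> space \<Lambda>. fst p \<in> J \<and> x \<le> fst p + snd p}"

lemma mem_reach: "(u, r) \<in> reach J x \<longleftrightarrow> 0 < r \<and> u \<in> J \<and> x \<le> u + r"
  by (auto simp: reach_def space_intensity)

lemma sets_reach[measurable]:
  assumes [measurable]: "J \<in> sets borel"
  shows "reach J x \<in> sets \<Lambda>"
proof -
  have [measurable]: "fst \<in> borel_measurable \<Lambda>"
    using measurable_fst[of "scale_measure (ennreal lam) lborel" \<mu>]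
    by (simp cong: measurable_cong_sets)
  have [measurable]: "snd \<in> borel_measurable \<Lambda>"
    using measurable_compose[OF measurable_snd measurable_mark] by simp
  show ?thesis
    unfolding reach_def by measurable
qed

lemma emeasure_reach:
  assumes "J \<in> sets borel"
  shows "emeasure \<Lambda> (reach J x) = ennreal lam * (\<integral>\<^sup>+ r. emeasure lborel {u\<in>J. x - r \<le> u} \<partial>\<mu>)"
  unfolding emeasure_intensity[OF sets_reach[OF assms]]
  by (intro arg_cong[where f = "(*) (ennreal lam)"] nn_integral_cong
      arg_cong[where f = "emeasure lborel"]) (auto simp: mem_reach space_mark)

lemma fmeasurable_reach:
  assumes J: "J \<in> sets borel" "bounded J"
  shows "reach J x \<in> fmeasurable \<Lambda>"
proof (rule fmeasurableI[OF sets_reach[OF J(1)]])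
  have "(\<integral>\<^sup>+ r. emeasure lborel {u\<in>J. x - r \<le> u} \<partial>\<mu>) \<le> (\<integral>\<^sup>+ r. emeasure lborel J \<partial>\<mu>)"
    using J(1) by (intro nn_integral_mono emeasure_mono) auto
  also have "\<dots> = emeasure lborel J"
    by (simp add: mark.emeasure_space_1)
  also have "\<dots> < \<infinity>"
    using J(2) by (rule emeasure_bounded_finite)
  finally show "emeasure \<Lambda> (reach J x) < \<infinity>"
    unfolding emeasure_reach[OF J(1)] by (auto simp: ennreal_mult_less_top)
qed

section \<open>Truncated means as intensities\<close>

definition mean_min :: "real \<Rightarrow> real" where
  "mean_min t = (LINT r|\<mu>. min r t)"

lemma integrable_min: "0 \<le> t \<Longrightarrow> integrable \<mu> (\<lambda>r. min r t)"
  by (rule mark.integrable_const_bound[of _ t]) (auto intro!: AE_I2 simp: space_mark)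

lemma mean_min_mono: "0 \<le> s \<Longrightarrow> s \<le> t \<Longrightarrow> mean_min s \<le> mean_min t"
  unfolding mean_min_def by (intro integral_mono integrable_min) auto

lemma nn_integral_min:
  assumes "0 \<le> t"
  shows "(\<integral>\<^sup>+ r. ennreal (min r t) \<partial>\<mu>) = ennreal (mean_min t)"
  unfolding mean_min_def using assms
  by (intro nn_integral_eq_integral integrable_min) (auto intro!: AE_I2 simp: space_mark)

lemma mean_min_nonneg: "0 \<le> t \<Longrightarrow> 0 \<le> mean_min t"
  unfolding mean_min_def by (intro integral_nonneg_AE AE_I2) (auto simp: space_mark)

text \<open>An interval of length \<open>r\<close> covers \<open>x\<close> iff it starts in
  \<open>[max 0 (x - r), x]\<close>, a segment of length \<open>min r x\<close>; averaging over
  \<open>r\<close> gives the exponent of the vacancy probability.\<close>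

lemma measure_reach_vacant:
  assumes "0 \<le> x"
  shows "measure \<Lambda> (reach {0..x} x) = lam * mean_min x"
proof -
  have "(\<integral>\<^sup>+ r. emeasure lborel {u\<in>{0..x}. x - r \<le> u} \<partial>\<mu>) = (\<integral>\<^sup>+ r. ennreal (min r x) \<partial>\<mu>)"
  proof (rule nn_integral_cong)
    fix r assume "r \<in> space \<mu>"
    then have "{u\<in>{0..x}. x - r \<le> u} = {max 0 (x - r)..x}" "max 0 (x - r) \<le> x"
        "x - max 0 (x - r) = min r x"
      using assms by (auto simp: space_mark)
    then show "emeasure lborel {u\<in>{0..x}. x - r \<le> u} = ennreal (min r x)"
      by simp
  qed
  then have "emeasure \<Lambda> (reach {0..x} x) = ennreal (lam * mean_min x)"
    using assms lam_pos by (simp add: emeasure_reach nn_integral_min ennreal_mult mean_min_nonneg)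
  then show ?thesis
    using assms lam_pos by (simp add: measure_def mean_min_nonneg)
qed

text \<open>Forbidding starts after \<open>x\<close> while still requiring reach to
  \<open>x + 1\<close> costs at most one unit of length for each mark, hence at most
  \<open>lam\<close> in intensity.\<close>

lemma measure_reach_ge:
  assumes "0 \<le> x"
  shows "lam * mean_min (x + 1) - lam \<le> measure \<Lambda> (reach {0..x} (x + 1))"
proof -
  \<comment> \<open>This is negative for \<open>r < 1\<close>; \<open>ennreal\<close> then truncates
    it to 0, the length of the empty slice.\<close>
  define g where "g r = x - max 0 (x + 1 - r)" for r
  have g[measurable]: "g \<in> borel_measurable \<mu>"
    unfolding g_def by measurable
  have slice: "emeasure lborel {u\<in>{0..x}. (x + 1) - r \<le> u} = ennreal (g r)" for r
  proof -
    have "{u\<in>{0..x}. (x + 1) - r \<le> u} = {max 0 (x + 1 - r)..x}"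
      by auto
    moreover have "emeasure lborel {l..x} = ennreal (x - l)" for l
      by (cases "l \<le> x") (simp_all add: ennreal_neg)
    ultimately show ?thesis
      by (simp only: g_def)
  qed
  have "ennreal (mean_min (x + 1)) = (\<integral>\<^sup>+ r. ennreal (min r (x + 1)) \<partial>\<mu>)"
    using assms by (simp add: nn_integral_min)
  also have "\<dots> \<le> (\<integral>\<^sup>+ r. ennreal (g r) + 1 \<partial>\<mu>)"
  proof (rule nn_integral_mono)
    fix r
    have "min r (x + 1) \<le> max 0 (g r) + 1"
      by (auto simp: g_def)
    then have "ennreal (min r (x + 1)) \<le> ennreal (max 0 (g r) + 1)"
      by (rule ennreal_leI)
    also have "\<dots> = ennreal (g r) + 1"
      by (simp add: ennreal_max_0)
    finally show "ennreal (min r (x + 1)) \<le> ennreal (g r) + 1" .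
  qed
  also have "\<dots> = (\<integral>\<^sup>+ r. ennreal (g r) \<partial>\<mu>) + 1"
    by (subst nn_integral_add) (auto simp: mark.emeasure_space_1)
  finally have "ennreal lam * ennreal (mean_min (x + 1))
      \<le> ennreal lam * ((\<integral>\<^sup>+ r. ennreal (g r) \<partial>\<mu>) + 1)"
    by (rule mult_left_mono) simp
  also have "\<dots> = emeasure \<Lambda> (reach {0..x} (x + 1)) + ennreal lam"
    by (subst emeasure_reach) (simp_all only: slice distrib_left mult_1_right, simp)
  also have "emeasure \<Lambda> (reach {0..x} (x + 1)) = ennreal (measure \<Lambda> (reach {0..x} (x + 1)))"
    by (intro emeasure_eq_measure2 fmeasurable_reach) auto
  finally show ?thesis
    using assms lam_pos mean_min_nonneg[of "x + 1"]
    by (simp add: ennreal_mult[symmetric] ennreal_plus[symmetric] del: ennreal_plus)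
qed

lemma mem_occupied_set:
  assumes "\<omega> \<in> space M"
  shows "x \<in> occupied_set (X \<omega>) \<longleftrightarrow> X \<omega> \<inter> reach {0..x} x \<noteq> {}"
  using points_in_space[OF assms] unfolding occupied_set_def
  by (force simp: mem_reach space_mark)

lemma occupied_set_nonneg: "occupied_set (X \<omega>) \<subseteq> {0..}"
  by (auto simp: occupied_set_def)

section \<open>Convergent integral: an occupied half-line\<close>

lemma ex_unbounded_component:
  assumes "summable (\<lambda>n. exp (- lam * mean_min (real n + 1)))"
  shows "AE \<omega> in M. has_unbounded_component (occupied_set (X \<omega>))"
proof -
  \<comment> \<open>Treating whole cells \<open>[n, n + 1]\<close> lets countably many events
    control all real points.\<close>
  define B where "B n = {\<omega>\<in>space M. X \<omega> \<inter> reach {0..real n} (real n + 1) = {}}" for n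
  have B: "B n \<in> events" for n
    unfolding B_def by (intro avoid_sets sets_reach) simp
  \<comment> \<open>The factor \<open>exp lam\<close> pays for the loss of \<open>lam\<close> in
    \<open>measure_reach_ge\<close>.\<close>
  have "prob (B n) \<le> exp lam * exp (- lam * mean_min (real n + 1))" for n
    unfolding B_def using measure_reach_ge[of "real n"]
    by (subst avoid_prob) (auto simp: exp_add[symmetric] intro!: fmeasurable_reach)
  then have "summable (\<lambda>n. prob (B n))"
    by (intro summable_comparison_test'[OF summable_mult[OF assms, of "exp lam"]]) simp
  then have "AE \<omega> in M. eventually (\<lambda>n. \<omega> \<in> space M - B n) sequentially"
    by (intro borel_cantelli_AE1) (auto simp: B emeasure_eq_measure)
  then show ?thesis
  proof (rule AE_mp, intro AE_I2 impI)
    fix \<omega> assume \<omega>: "\<omega> \<in> space M" and "eventually (\<lambda>n. \<omega> \<in> space M - B n) sequentially"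
    then obtain N where N: "\<And>n. n \<ge> N \<Longrightarrow> \<omega> \<notin> B n"
      by (auto simp: eventually_sequentially)
    have "x \<in> occupied_set (X \<omega>)" if "real N \<le> x" for x
    proof -
      define n where "n = nat \<lfloor>x\<rfloor>"
      have n: "N \<le> n" "real n \<le> x" "x < real n + 1"
        using that by (auto simp: n_def le_nat_floor)
      then obtain u r where "(u, r) \<in> X \<omega>" "(u, r) \<in> reach {0..real n} (real n + 1)"
        using N[of n] \<omega> by (auto simp: B_def)
      then show ?thesis
        using n by (force simp: mem_reach occupied_set_def)
    qed
    then show "has_unbounded_component (occupied_set (X \<omega>))"
      by (intro has_unbounded_componentI[of "real N"]) auto
  qed
qed

section \<open>Divergent integral: infinitely many vacant integers\<close>

text \<open>
  If \<open>m\<close> is vacant, an interval covering \<open>m + k\<close> must start after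
  \<open>m\<close>, so the vacant integers form a renewal process.
\<close>
lemma prob_vacant_renewal:
  fixes m N :: nat
  shows "prob {\<omega>\<in>space M. X \<omega> \<inter> reach {0..real m} m = {} \<and>
        (\<forall>k\<in>{1..N}. X \<omega> \<inter> reach {0..real (m + k)} (real (m + k)) \<noteq> {})}
    = prob {\<omega>\<in>space M. X \<omega> \<inter> reach {0..real m} m = {}} *
      prob {\<omega>\<in>space M. X \<omega> \<inter> {} = {} \<and> (\<forall>k\<in>{1..N}. X \<omega> \<inter> reach {0<..real k} k \<noteq> {})}"
proof -
  define G where "G = reach {0..real m} m"
  \<comment> \<open>The start \<open>a\<close> itself is excluded, so that \<open>D m k\<close> is
    disjoint from \<open>G\<close>, whose starts are at most \<open>m\<close>.\<close>
  define D where "D a k = reach {a<..a + real k} (a + real k)" for a :: real and k :: nat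
  have G: "G \<in> fmeasurable \<Lambda>"
    unfolding G_def by (intro fmeasurable_reach) simp_all
  have D: "D a k \<in> fmeasurable \<Lambda>" for a k
    unfolding D_def by (intro fmeasurable_reach) simp_all
  have reach_eq: "X \<omega> \<inter> reach {0..real (m + k)} (real (m + k)) \<noteq> {} \<longleftrightarrow> X \<omega> \<inter> D m k \<noteq> {}"
    if "X \<omega> \<inter> G = {}" for \<omega> k
  proof -
    have "reach {0..real (m + k)} (real (m + k)) \<subseteq> G \<union> D m k" "D m k \<subseteq> reach {0..real (m + k)} (real (m + k))"
      by (auto simp: G_def D_def mem_reach)
    with that show ?thesis
      by blast
  qed
  \<comment> \<open>Disjointness splits off \<open>G\<close>, and translation by \<open>m\<close>
    carries \<open>D 0 k\<close> to \<open>D m k\<close>. This is the hypothesis of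
    \<open>hit_prob_factor\<close> with an empty \<open>G'\<close> and
    \<open>c = measure \<Lambda> G\<close>.\<close>
  have "measure \<Lambda> (G \<union> (\<Union>k\<in>S. D m k)) = measure \<Lambda> G + measure \<Lambda> ({} \<union> (\<Union>k\<in>S. D 0 k))"
    if "S \<subseteq> {1..N}" for S
  proof -
    have "finite S"
      using that finite_subset by blast
    then have U: "(\<Union>k\<in>S. D a k) \<in> fmeasurable \<Lambda>" for a
      using D by (intro fmeasurable.finite_UN) auto
    have "measure \<Lambda> (G \<union> (\<Union>k\<in>S. D m k)) = measure \<Lambda> G + measure \<Lambda> (\<Union>k\<in>S. D m k)"
      using G U[of m] by (intro measure_Union) (auto simp: fmeasurable_def G_def D_def mem_reach)
    also have "measure \<Lambda> (\<Union>k\<in>S. D m k) = measure \<Lambda> (\<Union>k\<in>S. D 0 k)"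
      unfolding measure_def using fmeasurableD[OF U[of "real m"]] fmeasurableD[OF U[of 0]]
      by (intro arg_cong[where f = enn2real] emeasure_intensity_translate[where a = "real m"])
        (simp_all add: D_def mem_reach add.assoc)
    finally show ?thesis
      by simp
  qed
  then have "prob {\<omega>\<in>space M. X \<omega> \<inter> G = {} \<and> (\<forall>k\<in>{1..N}. X \<omega> \<inter> D m k \<noteq> {})}
    = exp (- measure \<Lambda> G) * prob {\<omega>\<in>space M. X \<omega> \<inter> {} = {} \<and> (\<forall>k\<in>{1..N}. X \<omega> \<inter> D 0 k \<noteq> {})}"
    using G D by (intro hit_prob_factor) auto
  moreover have "{\<omega>\<in>space M. X \<omega> \<inter> G = {} \<and> (\<forall>k\<in>{1..N}. X \<omega> \<inter> D m k \<noteq> {})}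
    = {\<omega>\<in>space M. X \<omega> \<inter> G = {} \<and>
        (\<forall>k\<in>{1..N}. X \<omega> \<inter> reach {0..real (m + k)} (real (m + k)) \<noteq> {})}"
    using reach_eq by blast
  ultimately show ?thesis
    using avoid_prob[OF G] by (simp add: G_def D_def)
qed

lemma no_unbounded_component:
  assumes "\<not> summable (\<lambda>n. exp (- lam * mean_min (real n)))"
  shows "AE \<omega> in M. \<not> has_unbounded_component (occupied_set (X \<omega>))"
proof -
  define A where "A n = {\<omega>\<in>space M. X \<omega> \<inter> reach {0..real n} n = {}}" for n :: nat
  have A: "A n \<in> events" for n
    unfolding A_def by (intro avoid_sets sets_reach) simp
  have prob_A: "prob (A n) = exp (- lam * mean_min (real n))" for n
    unfolding A_def
    by (subst avoid_prob) (auto simp: measure_reach_vacant intro!: fmeasurable_reach)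
  have "AE \<omega> in M. \<forall>m. \<omega> \<in> A m \<longrightarrow> (\<exists>n>m. \<omega> \<in> A n)"
  proof (rule renewal_recurrence)
    fix m N :: nat
    have "{\<omega>\<in>space M. \<omega> \<in> A m \<and> (\<forall>k\<in>{1..N}. \<omega> \<notin> A (m + k))}
      = {\<omega>\<in>space M. X \<omega> \<inter> reach {0..real m} m = {} \<and>
        (\<forall>k\<in>{1..N}. X \<omega> \<inter> reach {0..real (m + k)} (real (m + k)) \<noteq> {})}"
      by (auto simp: A_def)
    then show "prob {\<omega>\<in>space M. \<omega> \<in> A m \<and> (\<forall>k\<in>{1..N}. \<omega> \<notin> A (m + k))} = prob (A m) *
        prob {\<omega>\<in>space M. X \<omega> \<inter> {} = {} \<and> (\<forall>k\<in>{1..N}. X \<omega> \<inter> reach {0<..real k} k \<noteq> {})}"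
      unfolding A_def using prob_vacant_renewal[of m N] by simp
  qed (use assms A in \<open>auto simp: prob_A\<close>)
  \<comment> \<open>This provides the first vacant integer: the vacancy probability of 0 is
    \<open>exp 0 = 1\<close>.\<close>
  moreover have "mean_min 0 = 0"
    unfolding mean_min_def
    by (subst Bochner_Integration.integral_cong[OF refl, where g = "\<lambda>_. 0"]) (auto simp: space_mark)
  then have "AE \<omega> in M. \<omega> \<in> A 0"
    using A by (intro AE_prob_1) (simp add: prob_A)
  ultimately show ?thesis
  proof (eventually_elim, intro not_has_unbounded_componentI occupied_set_nonneg)
    fix \<omega> and b :: real
    assume next_vacant: "\<forall>m. \<omega> \<in> A m \<longrightarrow> (\<exists>n>m. \<omega> \<in> A n)" and "\<omega> \<in> A 0"
    have "\<exists>n\<ge>k. \<omega> \<in> A n" for k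
    proof (induction k)
      case 0
      then show ?case
        using \<open>\<omega> \<in> A 0\<close> by blast
    next
      case (Suc k)
      then show ?case
        using next_vacant by (meson Suc_leI le_less_trans)
    qed
    \<comment> \<open>The added 1 makes \<open>n > b\<close> strict.\<close>
    then obtain n where "nat \<lceil>b\<rceil> + 1 \<le> n" "\<omega> \<in> A n"
      by blast
    then show "\<exists>x>b. x \<notin> occupied_set (X \<omega>)"
      using mem_occupied_set[of \<omega>] by (intro exI[of _ "real n"]) (auto simp: A_def, linarith)
  qed
qed

end

section \<open>The dichotomy\<close>

theorem corollary1p2:
  fixes lam :: real
    and \<mu> :: "real measure"
    and R :: "'r measure" and \<rho> :: "'r \<Rightarrow> real"
    and M :: "'w measure" and X :: "'w \<Rightarrow> (real \<times> real) set"
  defines "I \<equiv> (\<integral>\<^sup>+ t\<in>{0..}. ennreal (exp (- lam * (LINT y|R. min (\<rho> y) t))) \<partial>lborel)"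
    and "E \<equiv> {\<omega>\<in>space M. has_unbounded_component (occupied_set (X \<omega>))}"
  assumes "lam > 0"
    and "prob_space \<mu>" and "sets \<mu> = sets (restrict_space borel {0<..})"
    and "prob_space R" and "\<rho> \<in> measurable R \<mu>" and "distr R \<mu> \<rho> = \<mu>"
    and "poisson_point_process M (scale_measure (ennreal lam) lborel \<Otimes>\<^sub>M \<mu>) X"
  shows "E \<in> sets (completion M) \<and>
    ((AE \<omega> in M. has_unbounded_component (occupied_set (X \<omega>))) \<longleftrightarrow> I < \<infinity>) \<and>
    (measure (completion M) E = 1 \<longleftrightarrow> I < \<infinity>) \<and>
    ((AE \<omega> in M. \<not> has_unbounded_component (occupied_set (X \<omega>))) \<longleftrightarrow> I = \<infinity>) \<and>
    (measure (completion M) E = 0 \<longleftrightarrow> I = \<infinity>)"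
proof -
  interpret avoid: poisson_avoidance M "scale_measure (ennreal lam) lborel \<Otimes>\<^sub>M \<mu>" X
    using assms by (intro poisson_avoidanceI)
  interpret mark: prob_space \<mu>
    by fact
  interpret boolean_percolation M lam \<mu> X
    using assms by unfold_locales (auto simp: poisson_point_process_def space_pair_measure)
  define f where "f t = exp (- lam * mean_min t)" for t
  \<comment> \<open>The expectation over \<open>R\<close> becomes an integral against the law
    \<open>\<mu>\<close> of \<open>\<rho>\<close>.\<close>
  have "(LINT y|R. min (\<rho> y) t) = mean_min t" for t
    using integral_distr[OF \<open>\<rho> \<in> measurable R \<mu>\<close>, of "\<lambda>r. min r t"] \<open>distr R \<mu> \<rho> = \<mu>\<close>
    by (simp add: mean_min_def)
  then have I: "I = (\<integral>\<^sup>+ t\<in>{0..}. ennreal (f t) \<partial>lborel)"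
    by (simp add: I_def f_def)
  have anti: "ennreal (f t) \<le> ennreal (f s)" if "0 \<le> s" "s \<le> t" for s t
    using mean_min_mono[OF that] lam_pos by (simp add: f_def)
  have finite_case: "AE \<omega> in M. has_unbounded_component (occupied_set (X \<omega>))" if "I < \<infinity>"
  proof -
    have "(\<Sum>n. ennreal (f (real n + 1))) < \<infinity>"
      using suminf_Suc_le_nn_integral_antimono[of "\<lambda>t. ennreal (f t)", OF anti] that
      unfolding I by (rule le_less_trans)
    then have "summable (\<lambda>n. f (real n + 1))"
      by (intro summable_suminf_not_top) (auto simp: f_def)
    then show ?thesis
      unfolding f_def by (rule ex_unbounded_component)
  qed
  have infinite_case: "AE \<omega> in M. \<not> has_unbounded_component (occupied_set (X \<omega>))" if "I = \<infinity>"
  proof -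
    have "\<infinity> \<le> (\<Sum>n. ennreal (f (real n)))"
      unfolding that[symmetric] unfolding I by (rule nn_integral_antimono_le_suminf) (rule anti)
    then have "\<not> summable (\<lambda>n. f (real n))"
      using ennreal_suminf_neq_top[of "\<lambda>n. f (real n)"] unfolding f_def by (auto simp only: infinity_ennreal_def top_unique exp_ge_zero)
    then show ?thesis
      unfolding f_def by (rule no_unbounded_component)
  qed
  \<comment> \<open>This exclusion turns the two one-way implications above into
    equivalences.\<close>
  have exclusive: "\<not> ((AE \<omega> in M. P \<omega>) \<and> (AE \<omega> in M. \<not> P \<omega>))" for P
  proof
    assume "(AE \<omega> in M. P \<omega>) \<and> (AE \<omega> in M. \<not> P \<omega>)"
    then have "AE \<omega> in M. P \<omega>" "AE \<omega> in M. \<not> P \<omega>"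
      by blast+
    then have "AE \<omega> in M. False"
      by eventually_elim simp
    then show False
      by simp
  qed
  \<comment> \<open>In either case \<open>E\<close> is null or co-null, which places it in the
    completion.\<close>
  interpret complete: prob_space "completion M"
    by (rule avoid.prob_space_completion)
  show ?thesis
  proof (cases "I = \<infinity>")
    case True
    then have null: "AE \<omega> in M. \<not> has_unbounded_component (occupied_set (X \<omega>))"
      by (rule infinite_case)
    then have "E \<in> null_sets (completion M)"
      by (simp add: E_def completion.null_sets_iff_AE AE_completion)
    then have "E \<in> sets (completion M)" "measure (completion M) E = 0"
      by (auto simp: null_sets_def measure_def)
    moreover have "\<not> (AE \<omega> in M. has_unbounded_component (occupied_set (X \<omega>)))"
      using null exclusive by blast
    ultimately show ?thesis
      using True null by (simp only: less_irrefl zero_neq_one simp_thms)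
  next
    case False
    then have fin: "I < \<infinity>"
      by (simp add: top.not_eq_extremum)
    then have full: "AE \<omega> in M. has_unbounded_component (occupied_set (X \<omega>))"
      by (rule finite_case)
    have AE_E: "AE \<omega> in completion M. \<omega> \<in> E"
      using AE_completion[OF full] AE_space by eventually_elim (simp add: E_def)
    then have "AE \<omega> in completion M. \<omega> \<in> space M \<longleftrightarrow> \<omega> \<in> E"
      by eventually_elim (simp add: E_def)
    then have E: "E \<in> sets (completion M)"
      by (rule completion.in_sets_AE) (auto simp: E_def)
    have measure_E: "measure (completion M) E = 1"
      using AE_E by (simp only: complete.prob_eq_1[OF E])
    have "\<not> (AE \<omega> in M. \<not> has_unbounded_component (occupied_set (X \<omega>)))"
      using full exclusive by blast
    then show ?thesis
      by (simp only: E measure_E False fin full simp_thms one_neq_zero)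
  qed
qed

end
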